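(* Let $a,b,c,\gamma,\theta>0$ and let $X$ have the rGB1-IWei distribution with parameters $(\gamma,\theta,a,b,c)$ and density $f$. Then the Shannon entropy $H(f)=-E[\log f(X)]$ is given by $$H(f)=-\log\left(\frac{c\,\theta\,\gamma}{B(a,b)}\right)+\frac{c}{B(a,b)}\sum_{j_1=0}^{\infty}\sum_{j_2=0}^{\infty}p_{j_1,b}\,p_{j_2,c(a+j_1)}\left\{\frac{\theta+1}{\theta}\cdot\frac{\log[(j_2+1)\gamma]-\Gamma'(1)}{j_2+1}-\frac{ac-1}{j_2+1}\bigl[\psi(1)-\psi(j_2+2)\bigr]+\frac{1}{(j_2+1)^2}-(b-1)\sum_{i=0}^{\infty}\frac{p_{i,j_2+1}}{i+1}\left[\psi(1)-\psi\left(\frac{i+1}{c}+1\right)\right]\right\}.$$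
   Context: $\Gamma$ is the Gamma function, $\Gamma'$ its derivative, $\psi=\Gamma'/\Gamma$ the digamma function, and $B(a,b)=\Gamma(a)\Gamma(b)/\Gamma(a+b)$ the Beta function. A positive random variable $X$ has the rGB1-IWei (reflected generalized beta of first type Inverse Weibull) distribution with parameters $\gamma,\theta,a,b,c>0$ if it has the density, for $x>0$, $$f(x)=\frac{c\,\gamma\,\theta\,x^{-\theta-1}e^{-\gamma x^{-\theta}}}{B(a,b)}\left[1-e^{-\gamma x^{-\theta}}\right]^{ac-1}\left(1-\left[1-e^{-\gamma x^{-\theta}}\right]^{c}\right)^{b-1}.$$ For a real number $s$ and an integer $j\ge 0$, $p_{j,s}=\dfrac{(-1)^j\,\Gamma(s)}{\Gamma(s-j)\,\Gamma(j+1)}$, understood as $(-1)^j\binom{s-1}{j}$ (with $\binom{s-1}{j}=\frac{(s-1)(s-2)\cdots(s-j)}{j!}$), which gives the value when the Gamma functions have poles (in particular $p_{i,j_2+1}=(-1)^i\binom{j_2}{i}$ vanishes for $i>j_2$). The multiple series is an iterated sum: the sum over $i$ innermost, then the sum over $j_2$, then the sum over $j_1$. *)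

theory Defs
  imports "HOL-Probability.Probability"
begin

text \<open>
  The density is extended by 0 to the non-positive half-line, so that it is a density
  with respect to \<open>lborel\<close> and carries the positivity (almost surely) of the random variable.
\<close>

definition rGB1_IWei_density ::
  "real \<Rightarrow> real \<Rightarrow> real \<Rightarrow> real \<Rightarrow> real \<Rightarrow> real \<Rightarrow> real"
where
  "rGB1_IWei_density \<gamma> \<theta> a b c x =
     (if x > 0 then
        c * \<gamma> * \<theta> * x powr (- \<theta> - 1) * exp (- \<gamma> * x powr (- \<theta>)) / Beta a b
        * (1 - exp (- \<gamma> * x powr (- \<theta>))) powr (a * c - 1)
        * (1 - (1 - exp (- \<gamma> * x powr (- \<theta>))) powr c) powr (b - 1)
      else 0)"

definition rGB1_IWei_distributed ::
  "'s measure \<Rightarrow> ('s \<Rightarrow> real) \<Rightarrow> real \<Rightarrow> real \<Rightarrow> real \<Rightarrow> real \<Rightarrow> real \<Rightarrow> bool"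
where
  "rGB1_IWei_distributed M X \<gamma> \<theta> a b c \<longleftrightarrow>
     distributed M lborel X (\<lambda>x. ennreal (rGB1_IWei_density \<gamma> \<theta> a b c x))"

text \<open>
  The Shannon entropy \<open>- E[log f(X)]\<close> (natural logarithm) of a random variable \<open>X\<close>
  with density \<open>f\<close>. It is meaningful only if \<open>ln (f X)\<close> is integrable, since the Bochner
  integral of a non-integrable function is 0.
\<close>

definition shannon_entropy :: "'s measure \<Rightarrow> ('s \<Rightarrow> real) \<Rightarrow> (real \<Rightarrow> real) \<Rightarrow> real" where
  "shannon_entropy M X f = - prob_space.expectation M (\<lambda>\<omega>. ln (f (X \<omega>)))"

definition p_coeff :: "nat \<Rightarrow> real \<Rightarrow> real" where
  "p_coeff j s = (-1) ^ j * ((s - 1) gchoose j)"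

text \<open>
  With the convention \<open>Gamma z = 0\<close> at the poles and \<open>x / 0 = 0\<close>, the expression by
  Gamma functions is valid even if \<open>s - j\<close> is a pole.
\<close>

lemma p_coeff_Gamma:
  assumes "s > 0"
  shows "p_coeff j s = (-1) ^ j * Gamma s / (Gamma (s - real j) * Gamma (real j + 1))"
proof -
  have "s \<notin> \<int>\<^sub>\<le>\<^sub>0"
    using assms by (auto elim!: nonpos_Ints_cases)
  then have "((s - 1) gchoose j) = Gamma s / (fact j * Gamma (s - real j))"
    using gbinomial_Gamma[of "s - 1" j] by (simp add: algebra_simps)
  moreover have "Gamma (real j + 1) = fact j"
    using Gamma_fact[of j, where 'a = real] by (simp add: add.commute)
  ultimately show ?thesis
    by (simp add: p_coeff_def mult.commute)
qed

text \<open>The library function \<open>Digamma\<close>, defined by a series, is the logarithmic derivative of \<open>Gamma\<close>.\<close>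

lemma Digamma_eq_deriv_Gamma:
  fixes x :: real
  assumes "x > 0"
  shows "Digamma x = deriv Gamma x / Gamma x"
proof -
  have "x \<notin> \<int>\<^sub>\<le>\<^sub>0"
    using assms by (auto elim!: nonpos_Ints_cases)
  then have "(Gamma has_field_derivative Gamma x * Digamma x) (at x)"
    by (rule has_field_derivative_Gamma)
  then have "deriv Gamma x = Gamma x * Digamma x"
    by (rule DERIV_imp_deriv)
  moreover have "Gamma x > 0"
    using assms by (rule Gamma_real_pos)
  ultimately show ?thesis
    by simp
qed

text \<open>
  The summands of the triple series: \<open>entropy_inner_term c j\<^sub>2 i\<close> is the summand of the
  innermost sum over \<open>i\<close>, and \<open>entropy_term \<gamma> \<theta> a b c j\<^sub>1 j\<^sub>2\<close> is the
  summand of the double sum over \<open>j\<^sub>1\<close> and \<open>j\<^sub>2\<close>.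
\<close>

definition entropy_inner_term :: "real \<Rightarrow> nat \<Rightarrow> nat \<Rightarrow> real" where
  "entropy_inner_term c j\<^sub>2 i =
     p_coeff i (real j\<^sub>2 + 1) / (real i + 1) * (Digamma 1 - Digamma ((real i + 1) / c + 1))"

definition entropy_term ::
  "real \<Rightarrow> real \<Rightarrow> real \<Rightarrow> real \<Rightarrow> real \<Rightarrow> nat \<Rightarrow> nat \<Rightarrow> real"
where
  "entropy_term \<gamma> \<theta> a b c j\<^sub>1 j\<^sub>2 =
     p_coeff j\<^sub>1 b * p_coeff j\<^sub>2 (c * (a + real j\<^sub>1)) *
       ((\<theta> + 1) / \<theta> * ((ln ((real j\<^sub>2 + 1) * \<gamma>) - deriv Gamma 1) / (real j\<^sub>2 + 1))
        - (a * c - 1) / (real j\<^sub>2 + 1) * (Digamma 1 - Digamma (real j\<^sub>2 + 2))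
        + 1 / (real j\<^sub>2 + 1) ^ 2
        - (b - 1) * (\<Sum>i. entropy_inner_term c j\<^sub>2 i))"

end

theory Submission
  imports Defs
begin

text \<open>
  In the variable \<open>r = 1 - exp (- \<gamma> * x powr (- \<theta>))\<close>, which maps the positive half-line onto
  the unit interval, the density becomes
  \<open>c / Beta a b * r powr (a * c - 1) * (1 - r powr c) powr (b - 1)\<close>, and its logarithm is an affine
  combination of \<open>ln (- ln (1 - r))\<close>, \<open>ln (1 - r)\<close>, \<open>ln r\<close> and \<open>ln (1 - r powr c)\<close>. The binomial
  series of \<open>(1 - r powr c) powr (b - 1)\<close> in powers of \<open>r powr c\<close>, and then that of
  \<open>r powr (c * (a + j\<^sub>1) - 1)\<close> in powers of \<open>1 - r\<close>, may be integrated termwise by dominated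
  convergence, since their coefficients are eventually of constant sign. This leaves integrals of
  \<open>(1 - r) ^ j\<close> against each of the four logarithms, which are derivatives at \<open>h = 0\<close> of Gamma and Beta
  integrals: \<open>ln T\<close> is the derivative of \<open>T powr h\<close>.
\<close>

section \<open>Bochner integrals over Lebesgue sets and change of variables\<close>

text \<open>Bridge between the gauge integral, in which the Gamma and Beta integrals and the change
  of variables are available, and the Bochner integral, in which dominated convergence is
  used.\<close>

lemma has_bochner_integral_lebesgue_on_iff:
  fixes f :: "real \<Rightarrow> real"
  assumes "S \<in> sets lebesgue"
  shows "has_bochner_integral (lebesgue_on S) f v \<longleftrightarrow> f absolutely_integrable_on S \<and> integral S f = v"
proof -
  have "has_bochner_integral (lebesgue_on S) f v
      \<longleftrightarrow> f absolutely_integrable_on S \<and> set_lebesgue_integral lebesgue S f = v"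
    using assms
    by (simp add: has_bochner_integral_restrict_space set_integrable_def set_lebesgue_integral_def)
       (simp add: has_bochner_integral_iff)
  then show ?thesis
    using set_lebesgue_integral_eq_integral(2) by metis
qed

lemma has_bochner_integral_change_of_variables:
  fixes f g g' :: "real \<Rightarrow> real"
  assumes "S \<in> sets lebesgue" and "g ` S \<in> sets lebesgue"
    and "\<And>x. x \<in> S \<Longrightarrow> (g has_field_derivative g' x) (at x)"
    and "inj_on g S"
  shows "has_bochner_integral (lebesgue_on S) (\<lambda>x. \<bar>g' x\<bar> * f (g x)) v
    \<longleftrightarrow> has_bochner_integral (lebesgue_on (g ` S)) f v"
  using assms has_absolute_integral_change_of_variables_1'[of S g g' f v]
  by (auto simp: has_bochner_integral_lebesgue_on_iff has_field_derivative_at_within)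

section \<open>Differentiation of powers under the integral sign\<close>

text \<open>Rests on \<open>\<bar>exp z - 1\<bar> \<le> \<bar>z\<bar> * exp \<bar>z\<bar>\<close> at
  \<open>z = h * ln t\<close>. The bound is free of \<open>h\<close>, so that it can serve as a
  dominating function.\<close>

lemma powr_diff_quotient_bound:
  fixes t h e :: real
  assumes "t > 0" "0 < h" "2 * h \<le> e"
  shows "\<bar>(t powr h - 1) / h\<bar> \<le> 2 / e * (t powr e + t powr (-e))"
proof -
  define l where "l = ln t"
  have exp_bound: "\<bar>exp z - 1\<bar> \<le> \<bar>z\<bar> * exp \<bar>z\<bar>" for z :: real
  proof (cases "z \<ge> 0")
    case True
    have "(1 - z) * exp z \<le> exp (-z) * exp z"
      using exp_ge_add_one_self[of "-z"] by (intro mult_right_mono) auto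
    with True show ?thesis by (simp add: algebra_simps flip: exp_add)
  next
    case False
    have "1 - exp z \<le> -z" using exp_ge_add_one_self[of z] by linarith
    also have "\<dots> \<le> -z * exp (-z)" using False by (simp add: mult_le_cancel_left1)
    finally show ?thesis using False by simp
  qed
  have e: "e > 0" using assms by linarith
  have "\<bar>t powr h - 1\<bar> \<le> h * \<bar>l\<bar> * exp (h * \<bar>l\<bar>)"
    using exp_bound[of "h * l"] assms by (simp add: powr_def l_def abs_mult)
  then have "\<bar>(t powr h - 1) / h\<bar> \<le> \<bar>l\<bar> * exp (h * \<bar>l\<bar>)"
    using assms by (simp add: field_simps)
  also have "\<dots> \<le> \<bar>l\<bar> * exp (e / 2 * \<bar>l\<bar>)"
    using assms mult_right_mono[of h "e / 2" "\<bar>l\<bar>"] by (intro mult_left_mono) auto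
  \<comment> \<open>Since \<open>h\<close> uses at most half of the exponent \<open>e\<close>, the
    other half can absorb the factor \<open>\<bar>l\<bar>\<close>, by \<open>y \<le> exp y\<close>
    at \<open>y = e / 2 * \<bar>l\<bar>\<close>.\<close>
  also have "\<dots> \<le> 2 / e * exp (e / 2 * \<bar>l\<bar>) * exp (e / 2 * \<bar>l\<bar>)"
  proof (rule mult_right_mono)
    have "e / 2 * \<bar>l\<bar> \<le> exp (e / 2 * \<bar>l\<bar>)"
      using exp_ge_add_one_self[of "e / 2 * \<bar>l\<bar>"] by linarith
    then show "\<bar>l\<bar> \<le> 2 / e * exp (e / 2 * \<bar>l\<bar>)"
      using e by (simp add: field_simps)
  qed simp
  also have "\<dots> = 2 / e * exp (e * \<bar>l\<bar>)"
    by (simp flip: exp_add)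
  also have "\<dots> \<le> 2 / e * (t powr e + t powr (-e))"
    using assms(1) e by (intro mult_left_mono) (auto simp: powr_def l_def abs_if)
  finally show ?thesis .
qed

text \<open>The difference quotients of \<open>F\<close> at 0 are integrals dominated by the
  integrands at the two endpoints \<open>h = e\<close> and \<open>h = -e\<close>. Integrability of
  the logarithmic integrand is thus a conclusion, obtained together with its value.\<close>

lemma has_bochner_integral_mult_ln:
  fixes g T :: "'a \<Rightarrow> real"
  assumes "e > 0" and T: "T \<in> borel_measurable M"
    and pos: "\<And>x. x \<in> space M \<Longrightarrow> T x > 0"
    and int: "\<And>h. \<bar>h\<bar> \<le> e \<Longrightarrow> has_bochner_integral M (\<lambda>x. g x * T x powr h) (F h)"
    and der: "(F has_field_derivative D) (at 0)"
  shows "has_bochner_integral M (\<lambda>x. g x * ln (T x)) D"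
proof -
  \<comment> \<open>Positivity of \<open>T x\<close> matters here: \<open>0 powr 0\<close> is 0,
    while a positive base gives 1.\<close>
  have int0: "has_bochner_integral M g (F 0)"
    using int[of 0] assms(1) pos
    by (simp cong: has_bochner_integral_cong add: order_less_imp_not_eq2)
  then have g[measurable]: "g \<in> borel_measurable M"
    by (auto simp: has_bochner_integral_iff)
  note T[measurable]
  \<comment> \<open>The factor \<open>e / 2\<close> secures \<open>2 * h n \<le> e\<close> already
    at \<open>n = 0\<close>.\<close>
  define h where "h n = e / 2 * inverse (real (Suc n))" for n
  have h: "h n > 0" "2 * h n \<le> e" "\<bar>h n\<bar> \<le> e" for n
    using assms(1) by (auto simp: h_def field_simps)
  have h0: "h \<longlonglongrightarrow> 0"
    unfolding h_def by (intro tendsto_mult_right_zero LIMSEQ_inverse_real_of_nat)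
  define s where "s n x = g x * ((T x powr h n - 1) / h n)" for n x
  define w where "w x = 2 / e * (norm (g x * T x powr e) + norm (g x * T x powr (-e)))" for x
  have s_int: "has_bochner_integral M (s n) ((F (h n) - F 0) / h n)" for n
    using has_bochner_integral_divide_zero[OF
        has_bochner_integral_diff[OF int[OF h(3)[of n]] int0], of "h n"]
    by (simp add: s_def[abs_def] algebra_simps)
  have w_int: "integrable M w"
    unfolding w_def using int[of e] int[of "-e"] assms(1)
    by (intro integrable_mult_right integrable_add integrable_norm)
       (auto simp: has_bochner_integral_iff)
  have lim: "AE x in M. (\<lambda>n. s n x) \<longlonglongrightarrow> g x * ln (T x)"
  proof (rule AE_I2)
    fix x assume "x \<in> space M"
    then have "((\<lambda>y. T x powr y) has_field_derivative ln (T x)) (at 0)"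
      using pos[of x] by (auto intro!: derivative_eq_intros)
    then have "((\<lambda>k. (T x powr k - 1) / k) \<longlongrightarrow> ln (T x)) (at 0)"
      using pos[OF \<open>x \<in> space M\<close>] by (simp add: DERIV_def)
    moreover have "filterlim h (at 0) sequentially"
      using h h0 by (intro filterlim_atI) (auto simp: order_less_imp_not_eq2)
    ultimately show "(\<lambda>n. s n x) \<longlonglongrightarrow> g x * ln (T x)"
      unfolding s_def by (intro tendsto_mult tendsto_const) (rule filterlim_compose)
  qed
  have bound: "AE x in M. norm (s n x) \<le> w x" for n
  proof (rule AE_I2)
    fix x assume "x \<in> space M"
    then have "\<bar>(T x powr h n - 1) / h n\<bar> \<le> 2 / e * (T x powr e + T x powr (-e))"
      by (intro powr_diff_quotient_bound h pos)
    then have "\<bar>g x\<bar> * \<bar>(T x powr h n - 1) / h n\<bar> \<le> \<bar>g x\<bar> * (2 / e * (T x powr e + T x powr (-e)))"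
      by (intro mult_left_mono) auto
    also have "\<dots> = w x"
      by (simp add: w_def abs_mult algebra_simps)
    finally show "norm (s n x) \<le> w x"
      by (simp add: s_def abs_mult)
  qed
  have s_meas: "s n \<in> borel_measurable M" for n
    using s_int[of n] by (auto simp: has_bochner_integral_iff)
  have f_meas: "(\<lambda>x. g x * ln (T x)) \<in> borel_measurable M"
    by measurable
  have "integrable M (\<lambda>x. g x * ln (T x))"
    by (rule integrable_dominated_convergence[OF f_meas s_meas w_int lim bound])
  moreover have "(\<lambda>n. integral\<^sup>L M (s n)) \<longlonglongrightarrow> integral\<^sup>L M (\<lambda>x. g x * ln (T x))"
    by (rule integral_dominated_convergence[OF f_meas s_meas w_int lim bound])
  moreover have "(\<lambda>n. integral\<^sup>L M (s n)) \<longlonglongrightarrow> D"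
  proof -
    have "((\<lambda>k. (F k - F 0) / k) \<longlongrightarrow> D) (at 0)"
      using der by (simp add: DERIV_def)
    moreover have "filterlim h (at 0) sequentially"
      using h h0 by (intro filterlim_atI) (auto simp: order_less_imp_not_eq2)
    ultimately have "(\<lambda>n. (F (h n) - F 0) / h n) \<longlonglongrightarrow> D"
      by (rule filterlim_compose)
    then show ?thesis
      using s_int by (simp add: has_bochner_integral_iff)
  qed
  ultimately show ?thesis
    by (auto simp: has_bochner_integral_iff intro: LIMSEQ_unique)
qed

section \<open>The binomial series and its termwise integration\<close>

lemma p_coeff_sums:
  assumes "\<bar>x\<bar> < 1"
  shows "(\<lambda>j. p_coeff j s * x ^ j) sums (1 - x) powr (s - 1)"
  using gen_binomial_real[of "-x" "s - 1"] assms
  by (simp add: p_coeff_def power_minus[of x] mult.commute mult.left_commute)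

lemma p_coeff_Suc: "p_coeff (Suc j) s = p_coeff j s * ((real j + 1 - s) / (real j + 1))"
  by (simp add: p_coeff_def gbinomial_Suc_rec field_simps)

text \<open>The coefficients have constant sign from some index on, so that the absolute series
  differs from \<open>\<plusminus>(1 - x) powr (s - 1)\<close> by a polynomial.\<close>

lemma p_coeff_abs_sum_bound:
  obtains C where "C \<ge> 0"
    and "\<And>x n. 0 \<le> x \<Longrightarrow> x < 1 \<Longrightarrow> (\<Sum>j<n. \<bar>p_coeff j s\<bar> * x ^ j) \<le> (1 - x) powr (s - 1) + C"
proof
  \<comment> \<open>For \<open>j \<ge> N\<close> the ratio \<open>(j + 1 - s) / (j + 1)\<close> of
    consecutive coefficients is nonnegative, so the sign \<open>\<sigma>\<close> of the coefficient
    at \<open>N\<close> persists.\<close>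
  define N where "N = nat \<lceil>s\<rceil>"
  define \<sigma> :: real where "\<sigma> = (if p_coeff N s \<ge> 0 then 1 else -1)"
  have sign: "\<bar>p_coeff j s\<bar> = \<sigma> * p_coeff j s" if "N \<le> j" for j
  proof -
    have "0 \<le> \<sigma> * p_coeff j s"
      using that
    proof (induction j rule: dec_induct)
      case base
      then show ?case by (auto simp: \<sigma>_def)
    next
      case (step j)
      have "s \<le> real j" using step(1) unfolding N_def by linarith
      then have "0 \<le> (\<sigma> * p_coeff j s) * ((real j + 1 - s) / (real j + 1))"
        using step(3) by (intro mult_nonneg_nonneg[OF _ divide_nonneg_nonneg]) auto
      then show ?case unfolding p_coeff_Suc by (simp only: mult.assoc)
    qed
    then show ?thesis by (auto simp: \<sigma>_def split: if_splits)
  qed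
  let ?C = "\<Sum>j<N. 2 * \<bar>p_coeff j s\<bar>"
  show "?C \<ge> 0" by (intro sum_nonneg) auto
  show "(\<Sum>j<n. \<bar>p_coeff j s\<bar> * x ^ j) \<le> (1 - x) powr (s - 1) + ?C" if x: "0 \<le> x" "x < 1" for x n
  proof -
    \<comment> \<open>The correction for coefficients of the wrong sign: it vanishes from
      \<open>N\<close> on and is otherwise at most twice the absolute coefficient, whence the
      constant \<open>?C\<close>.\<close>
    define q where "q j = \<bar>p_coeff j s\<bar> - \<sigma> * p_coeff j s" for j
    have "(\<lambda>j. q j * x ^ j) sums (\<Sum>j<N. q j * x ^ j)"
      by (rule sums_finite) (auto simp: q_def sign)
    then have "(\<lambda>j. \<sigma> * (p_coeff j s * x ^ j) + q j * x ^ j) sums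
        (\<sigma> * (1 - x) powr (s - 1) + (\<Sum>j<N. q j * x ^ j))"
      using x by (intro sums_add sums_mult p_coeff_sums) auto
    then have S: "(\<lambda>j. \<bar>p_coeff j s\<bar> * x ^ j) sums (\<sigma> * (1 - x) powr (s - 1) + (\<Sum>j<N. q j * x ^ j))"
      by (simp add: q_def algebra_simps)
    have "(\<Sum>j<n. \<bar>p_coeff j s\<bar> * x ^ j) \<le> (\<Sum>j. \<bar>p_coeff j s\<bar> * x ^ j)"
      using S x by (intro sum_le_suminf) (auto simp: sums_iff)
    also have "\<dots> = \<sigma> * (1 - x) powr (s - 1) + (\<Sum>j<N. q j * x ^ j)"
      using S by (simp add: sums_iff)
    also have "\<dots> \<le> (1 - x) powr (s - 1) + ?C"
    proof (intro add_mono sum_mono)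
      show "\<sigma> * (1 - x) powr (s - 1) \<le> (1 - x) powr (s - 1)"
        using powr_ge_zero[of "1 - x" "s - 1"] by (simp add: \<sigma>_def)
      fix j
      have "x ^ j \<le> 1" using x by (intro power_le_one) auto
      moreover have "0 \<le> q j" "q j \<le> 2 * \<bar>p_coeff j s\<bar>"
        by (auto simp: q_def \<sigma>_def)
      ultimately show "q j * x ^ j \<le> 2 * \<bar>p_coeff j s\<bar>"
        using x by (meson mult_left_le order_trans)
    qed
    finally show ?thesis .
  qed
qed

text \<open>By the bound on the absolute partial sums, all partial sums of the integrand are
  dominated by \<open>\<bar>(1 - v) powr (s - 1) * L\<bar> + C * \<bar>L\<bar>\<close>. This
  accounts for the two integrability hypotheses.\<close>

lemma p_coeff_sums_integral:
  fixes v L :: "'a \<Rightarrow> real"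
  assumes v: "v \<in> borel_measurable M"
    and v01: "\<And>x. x \<in> space M \<Longrightarrow> 0 \<le> v x \<and> v x < 1"
    and L: "integrable M L"
    and sL: "integrable M (\<lambda>x. (1 - v x) powr (s - 1) * L x)"
  shows "(\<lambda>j. p_coeff j s * (\<integral>x. v x ^ j * L x \<partial>M)) sums (\<integral>x. (1 - v x) powr (s - 1) * L x \<partial>M)"
proof -
  obtain C where C: "C \<ge> 0"
    "\<And>x n. 0 \<le> x \<Longrightarrow> x < 1 \<Longrightarrow> (\<Sum>j<n. \<bar>p_coeff j s\<bar> * x ^ j) \<le> (1 - x) powr (s - 1) + C"
    by (rule p_coeff_abs_sum_bound[of s]) blast
  note v[measurable]
  have [measurable]: "L \<in> borel_measurable M" using L by auto
  have vL: "integrable M (\<lambda>x. v x ^ j * L x)" for j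
  proof (rule Bochner_Integration.integrable_bound[OF L])
    show "AE x in M. norm (v x ^ j * L x) \<le> norm (L x)"
      using v01
      by (intro AE_I2)
         (auto simp: abs_mult less_imp_le intro!: mult_left_le_one_le power_le_one zero_le_power)
  qed measurable
  define w where "w x = norm ((1 - v x) powr (s - 1) * L x) + C * norm (L x)" for x
  have w: "integrable M w"
    unfolding w_def using L sL by auto
  define S where "S n x = (\<Sum>j<n. p_coeff j s * v x ^ j) * L x" for n x
  have "(\<lambda>n. integral\<^sup>L M (S n)) \<longlonglongrightarrow> (\<integral>x. (1 - v x) powr (s - 1) * L x \<partial>M)"
  proof (rule integral_dominated_convergence[OF _ _ w])
    show "AE x in M. (\<lambda>n. S n x) \<longlonglongrightarrow> (1 - v x) powr (s - 1) * L x"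
    proof (rule AE_I2)
      fix x assume "x \<in> space M"
      then have "(\<lambda>j. p_coeff j s * v x ^ j) sums (1 - v x) powr (s - 1)"
        using v01[of x] by (intro p_coeff_sums) auto
      then show "(\<lambda>n. S n x) \<longlonglongrightarrow> (1 - v x) powr (s - 1) * L x"
        unfolding sums_def S_def by (rule tendsto_mult_right)
    qed
    show "AE x in M. norm (S n x) \<le> w x" for n
    proof (rule AE_I2)
      fix x assume "x \<in> space M"
      then have vx: "0 \<le> v x" "v x < 1" using v01 by auto
      have "\<bar>\<Sum>j<n. p_coeff j s * v x ^ j\<bar> \<le> (\<Sum>j<n. \<bar>p_coeff j s * v x ^ j\<bar>)"
        by (rule sum_abs)
      also have "\<dots> = (\<Sum>j<n. \<bar>p_coeff j s\<bar> * v x ^ j)"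
        using vx by (simp add: abs_mult)
      also have "\<dots> \<le> (1 - v x) powr (s - 1) + C"
        by (rule C(2)[OF vx])
      finally have "\<bar>\<Sum>j<n. p_coeff j s * v x ^ j\<bar> * \<bar>L x\<bar> \<le> ((1 - v x) powr (s - 1) + C) * \<bar>L x\<bar>"
        by (intro mult_right_mono) auto
      then show "norm (S n x) \<le> w x"
        by (simp add: S_def w_def abs_mult algebra_simps)
    qed
  qed (unfold S_def, measurable)
  moreover have "integral\<^sup>L M (S n) = (\<Sum>j<n. p_coeff j s * (\<integral>x. v x ^ j * L x \<partial>M))" for n
    unfolding S_def using vL by (simp add: sum_distrib_right mult.assoc)
  ultimately show ?thesis
    by (simp add: sums_def)
qed

section \<open>Beta integrals with logarithmic factors\<close>

abbreviation unit_interval_measure :: "real measure"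
  where "unit_interval_measure \<equiv> lebesgue_on {0<..<1}"

lemma borel_measurable_unit_interval:
  "f \<in> borel_measurable borel \<Longrightarrow> f \<in> borel_measurable unit_interval_measure"
  by (intro measurable_restrict_space1 measurable_completion) simp

lemma has_bochner_integral_eq:
  assumes "has_bochner_integral M f v" and "\<And>x. x \<in> space M \<Longrightarrow> f x = g x" and "v = w"
  shows "has_bochner_integral M g w"
  using assms has_bochner_integral_cong[of M M f g v w] by simp

lemma pos_notin_nonpos_Ints: "x > 0 \<Longrightarrow> x \<notin> \<int>\<^sub>\<le>\<^sub>0" for x :: real
  by (auto elim!: nonpos_Ints_cases)

lemma powr_image_unit_interval:
  fixes c :: real
  assumes "c > 0"
  shows "(\<lambda>r. r powr c) ` {0<..<1} = {0<..<1}"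
proof (intro equalityI subsetI)
  fix y :: real assume y: "y \<in> {0<..<1}"
  then have "y = (y powr (1 / c)) powr c" using assms by (simp add: powr_powr)
  moreover have "y powr (1 / c) \<in> {0<..<1}"
    using y assms powr_less_mono2[of "1 / c" y 1] by simp
  ultimately show "y \<in> (\<lambda>r. r powr c) ` {0<..<1}" by blast
qed (use assms powr_less_mono2[of c _ 1] in auto)

text \<open>The integrand is nonnegative, so its gauge integral is absolute; removing the endpoints
  changes nothing.\<close>

lemma has_bochner_integral_Beta:
  fixes p q :: real
  assumes "p > 0" "q > 0"
  shows "has_bochner_integral unit_interval_measure (\<lambda>r. r powr (p - 1) * (1 - r) powr (q - 1)) (Beta p q)"
proof -
  have I: "((\<lambda>r. r powr (p - 1) * (1 - r) powr (q - 1)) has_integral Beta p q) {0<..<1}"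
    using has_integral_Beta_real[OF assms] by (simp add: has_integral_Icc_iff_Ioo)
  then have "(\<lambda>r. r powr (p - 1) * (1 - r) powr (q - 1)) absolutely_integrable_on {0<..<1}"
    by (intro nonnegative_absolutely_integrable_1) auto
  with I show ?thesis
    by (simp add: has_bochner_integral_lebesgue_on_iff integral_unique)
qed

text \<open>The substitution \<open>w = r powr c\<close> reduces this to the Beta integral with
  parameters \<open>p / c\<close> and \<open>q\<close>.\<close>

lemma has_bochner_integral_Beta_powr:
  fixes p q c :: real
  assumes "p > 0" "q > 0" "c > 0"
  shows "has_bochner_integral unit_interval_measure
    (\<lambda>r. r powr (p - 1) * (1 - r powr c) powr (q - 1)) (Beta (p / c) q / c)"
proof -
  let ?f = "\<lambda>w. w powr (p / c - 1) * (1 - w) powr (q - 1) / c"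
  have "has_bochner_integral unit_interval_measure ?f (Beta (p / c) q / c)"
    using assms by (intro has_bochner_integral_divide_zero has_bochner_integral_Beta) auto
  moreover have "((\<lambda>r. r powr c) has_field_derivative c * r powr (c - 1)) (at r)" if "r \<in> {0<..<1}" for r
    using that by (intro has_real_derivative_powr) auto
  moreover have "inj_on (\<lambda>r. r powr c) {0<..<1}"
    using assms by (intro inj_on_inverseI[where g = "\<lambda>y. y powr (1 / c)"]) (simp add: powr_powr)
  ultimately have "has_bochner_integral unit_interval_measure
      (\<lambda>r. \<bar>c * r powr (c - 1)\<bar> * ?f (r powr c)) (Beta (p / c) q / c)"
    using assms by (subst has_bochner_integral_change_of_variables) (auto simp: powr_image_unit_interval)
  then show ?thesis
  proof (rule has_bochner_integral_eq)
    fix r assume "r \<in> space unit_interval_measure"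
    then have "r > 0" by simp
    have "r powr (c - 1) * (r powr c) powr (p / c - 1) = r powr (p - 1)"
      using assms by (simp add: powr_powr algebra_simps flip: powr_add)
    then show "\<bar>c * r powr (c - 1)\<bar> * ?f (r powr c) = r powr (p - 1) * (1 - r powr c) powr (q - 1)"
      using assms by (simp add: abs_mult mult.assoc[symmetric])
  qed simp
qed

text \<open>Replacing \<open>p\<close> by \<open>p + h\<close> multiplies the integrand by
  \<open>r powr h\<close>, so the derivative in \<open>h\<close> inserts \<open>ln r\<close>. The
  inner derivative of \<open>(p + h) / c\<close> yields the second factor \<open>1 / c\<close>, and
  \<open>e = p / 2\<close> keeps \<open>p + h\<close> positive.\<close>

lemma has_bochner_integral_Beta_powr_ln:
  fixes p q c :: real
  assumes "p > 0" "q > 0" "c > 0"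
  shows "has_bochner_integral unit_interval_measure
    (\<lambda>r. r powr (p - 1) * (1 - r powr c) powr (q - 1) * ln r)
    (Beta (p / c) q * (Digamma (p / c) - Digamma (p / c + q)) / c\<^sup>2)"
proof (rule has_bochner_integral_mult_ln[where e = "p / 2" and F = "\<lambda>h. Beta ((p + h) / c) q / c"])
  fix h :: real assume h: "\<bar>h\<bar> \<le> p / 2"
  have "has_bochner_integral unit_interval_measure
    (\<lambda>r. r powr (p + h - 1) * (1 - r powr c) powr (q - 1)) (Beta ((p + h) / c) q / c)"
    using assms h by (intro has_bochner_integral_Beta_powr) linarith+
  then show "has_bochner_integral unit_interval_measure
    (\<lambda>r. r powr (p - 1) * (1 - r powr c) powr (q - 1) * r powr h) (Beta ((p + h) / c) q / c)"
    by (rule has_bochner_integral_eq) (simp_all add: ac_simps add_diff_eq flip: powr_add)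
next
  \<comment> \<open>The point \<open>(p + 0) / c\<close> stays unsimplified so that it matches the
    inner function at 0 in the chain rule below.\<close>
  have "((\<lambda>x. Beta x q) has_field_derivative
      Beta (p / c) q * (Digamma (p / c) - Digamma (p / c + q))) (at ((p + 0) / c))"
    using assms by (intro DERIV_cong[OF has_field_derivative_Beta1] pos_notin_nonpos_Ints)
      (auto intro: add_pos_pos)
  note [derivative_intros] = DERIV_chain2[where f = "\<lambda>x. Beta x q" and g = "\<lambda>h. (p + h) / c", OF this]
  show "((\<lambda>h. Beta ((p + h) / c) q / c) has_field_derivative
      Beta (p / c) q * (Digamma (p / c) - Digamma (p / c + q)) / c\<^sup>2) (at 0)"
    using assms by (auto intro!: derivative_eq_intros simp: power2_eq_square)
qed (use assms in \<open>auto intro!: borel_measurable_unit_interval\<close>)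

text \<open>Here the second parameter is shifted: \<open>q + h\<close> multiplies the integrand by
  \<open>(1 - r powr c) powr h\<close>.\<close>

lemma has_bochner_integral_Beta_powr_ln1m:
  fixes p q c :: real
  assumes "p > 0" "q > 0" "c > 0"
  shows "has_bochner_integral unit_interval_measure
    (\<lambda>r. r powr (p - 1) * (1 - r powr c) powr (q - 1) * ln (1 - r powr c))
    (Beta (p / c) q * (Digamma q - Digamma (p / c + q)) / c)"
proof (rule has_bochner_integral_mult_ln[where e = "q / 2" and F = "\<lambda>h. Beta (p / c) (q + h) / c"])
  fix h :: real assume h: "\<bar>h\<bar> \<le> q / 2"
  have "has_bochner_integral unit_interval_measure
    (\<lambda>r. r powr (p - 1) * (1 - r powr c) powr (q + h - 1)) (Beta (p / c) (q + h) / c)"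
    using assms h by (intro has_bochner_integral_Beta_powr) linarith+
  then show "has_bochner_integral unit_interval_measure
    (\<lambda>r. r powr (p - 1) * (1 - r powr c) powr (q - 1) * (1 - r powr c) powr h) (Beta (p / c) (q + h) / c)"
    by (rule has_bochner_integral_eq) (simp_all add: mult.assoc diff_add_eq flip: powr_add)
next
  have "((\<lambda>x. Beta (p / c) x) has_field_derivative
      Beta (p / c) q * (Digamma q - Digamma (p / c + q))) (at (q + 0))"
    using assms by (intro DERIV_cong[OF has_field_derivative_Beta2] pos_notin_nonpos_Ints)
      (auto intro: add_pos_pos)
  note [derivative_intros] = DERIV_chain2[where f = "Beta (p / c)" and g = "\<lambda>h. q + h", OF this]
  show "((\<lambda>h. Beta (p / c) (q + h) / c) has_field_derivative
      Beta (p / c) q * (Digamma q - Digamma (p / c + q)) / c) (at 0)"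
    using assms by (auto intro!: derivative_eq_intros)
next
  fix x :: real assume "x \<in> space unit_interval_measure"
  then show "0 < 1 - x powr c"
    using assms powr_less_mono2[of c x 1] by simp
qed (use assms in \<open>auto intro!: borel_measurable_unit_interval\<close>)

lemma Beta_1: "n > 0 \<Longrightarrow> Beta 1 n = 1 / n" "n > 0 \<Longrightarrow> Beta n 1 = 1 / n" for n :: real
  using pos_notin_nonpos_Ints[of n]
  by (simp_all add: Beta_def Gamma_plus1 Gamma_eq_zero_iff add.commute[of 1])

section \<open>Moments of the four logarithms against powers of \<open>1 - r\<close>\<close>

lemma has_bochner_integral_pow:
  "has_bochner_integral unit_interval_measure (\<lambda>r. (1 - r) ^ j) (1 / (real j + 1))"
proof -
  have "has_bochner_integral unit_interval_measure
      (\<lambda>r. r powr (1 - 1) * (1 - r) powr (real j + 1 - 1)) (Beta 1 (real j + 1))"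
    by (rule has_bochner_integral_Beta) auto
  then show ?thesis
    by (rule has_bochner_integral_eq)
       (auto simp: powr_realpow Beta_1)
qed

lemma has_bochner_integral_pow_ln:
  "has_bochner_integral unit_interval_measure (\<lambda>r. (1 - r) ^ j * ln r)
    ((Digamma 1 - Digamma (real j + 2)) / (real j + 1))"
proof -
  have "has_bochner_integral unit_interval_measure
      (\<lambda>r. r powr (1 - 1) * (1 - r powr 1) powr (real j + 1 - 1) * ln r)
      (Beta (1 / 1) (real j + 1) * (Digamma (1 / 1) - Digamma (1 / 1 + (real j + 1))) / 1\<^sup>2)"
    by (rule has_bochner_integral_Beta_powr_ln) auto
  then show ?thesis
    by (rule has_bochner_integral_eq)
       (auto simp: powr_realpow Beta_1 add.commute)
qed

lemma has_bochner_integral_pow_ln1m: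
  "has_bochner_integral unit_interval_measure (\<lambda>r. (1 - r) ^ j * ln (1 - r)) (- (1 / (real j + 1)\<^sup>2))"
proof -
  have "has_bochner_integral unit_interval_measure
      (\<lambda>r. r powr (1 - 1) * (1 - r powr 1) powr (real j + 1 - 1) * ln (1 - r powr 1))
      (Beta (1 / 1) (real j + 1) * (Digamma (real j + 1) - Digamma (1 / 1 + (real j + 1))) / 1)"
    by (rule has_bochner_integral_Beta_powr_ln1m) auto
  \<comment> \<open>The recurrence collapses the \<open>Digamma\<close> difference to
    \<open>- 1 / (j + 1)\<close>; the Beta factor contributes another
    \<open>1 / (j + 1)\<close>.\<close>
  moreover have "Digamma (1 + (real j + 1)) = Digamma (real j + 1) + 1 / (real j + 1)"
    using Digamma_plus1[of "real j + 1"] by (simp add: add.commute)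
  ultimately show ?thesis
    by (elim has_bochner_integral_eq) (auto simp: powr_realpow Beta_1 power2_eq_square)
qed

text \<open>With \<open>t = - (j + 1) * ln (1 - r)\<close>, the integral of
  \<open>(1 - r) ^ j * (- ln (1 - r)) powr h\<close> becomes a Gamma integral with value
  \<open>F h\<close>. The bound \<open>1 / 2\<close> on \<open>h\<close> keeps the Gamma argument
  positive.\<close>

lemma has_bochner_integral_pow_ln_neg_ln:
  "has_bochner_integral unit_interval_measure (\<lambda>r. (1 - r) ^ j * ln (- ln (1 - r)))
    ((deriv Gamma 1 - ln (real j + 1)) / (real j + 1))"
proof (rule has_bochner_integral_mult_ln
    [where e = "1 / 2" and F = "\<lambda>h. Gamma (1 + h) * (real j + 1) powr (-1 - h)"])
  define n where "n = real j + 1"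
  have n: "n > 0" by (simp add: n_def)
  fix h :: real assume h: "\<bar>h\<bar> \<le> 1 / 2"
  let ?g = "\<lambda>r. - n * ln (1 - r)"
  have "((\<lambda>t. t powr h / exp t) has_integral Gamma (1 + h)) {0..}"
    using Gamma_integral_real[of "1 + h"] h by simp
  \<comment> \<open>The null point 0 is removed so that the domain equals the image of the open unit
    interval.\<close>
  then have "((\<lambda>t. if t \<in> {0<..} then t powr h / exp t else 0) has_integral Gamma (1 + h)) {0..}"
    by (rule has_integral_spike [of "{0}", rotated 2]) auto
  then have I: "((\<lambda>t. t powr h / exp t) has_integral Gamma (1 + h)) {0<..}"
    by (subst (asm) has_integral_restrict) auto
  have img: "?g ` {0<..<1} = {0<..}"
  proof (intro equalityI subsetI)
    fix t :: real assume t: "t \<in> {0<..}"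
    then have "t = ?g (1 - exp (- t / n))" "1 - exp (- t / n) \<in> {0<..<1}"
      using n by auto
    then show "t \<in> ?g ` {0<..<1}" by blast
  qed (use n in \<open>auto simp: mult_less_0_iff\<close>)
  have "(\<lambda>t. t powr h / exp t) absolutely_integrable_on {0<..}"
    using I by (intro nonnegative_absolutely_integrable_1) auto
  then have "has_bochner_integral (lebesgue_on (?g ` {0<..<1})) (\<lambda>t. t powr h / exp t) (Gamma (1 + h))"
    using I unfolding img by (simp add: has_bochner_integral_lebesgue_on_iff integral_unique)
  moreover have "(?g has_field_derivative n / (1 - r)) (at r)" if "r \<in> {0<..<1}" for r
    using that by (auto intro!: derivative_eq_intros)
  moreover have "inj_on ?g {0<..<1}"
    using n by (auto simp: inj_on_def)
  moreover have "?g ` {0<..<1} \<in> sets lebesgue"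
    unfolding img by simp
  ultimately have "has_bochner_integral unit_interval_measure
      (\<lambda>r. \<bar>n / (1 - r)\<bar> * (?g r powr h / exp (?g r))) (Gamma (1 + h))"
    by (subst has_bochner_integral_change_of_variables) auto
  \<comment> \<open>The factor \<open>n powr (-1 - h)\<close> cancels the \<open>n\<close> of the
    Jacobian and the \<open>n powr h\<close> coming from \<open>t powr h\<close>.\<close>
  then have "has_bochner_integral unit_interval_measure
      (\<lambda>r. n powr (-1 - h) * (\<bar>n / (1 - r)\<bar> * (?g r powr h / exp (?g r))))
      (n powr (-1 - h) * Gamma (1 + h))"
    by (rule has_bochner_integral_mult_right)
  then show "has_bochner_integral unit_interval_measure
    (\<lambda>r. (1 - r) ^ j * (- ln (1 - r)) powr h) (Gamma (1 + h) * (real j + 1) powr (-1 - h))"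
  proof (rule has_bochner_integral_eq)
    fix r assume "r \<in> space unit_interval_measure"
    then have r: "0 < r" "r < 1" by auto
    have E1: "exp (?g r) = 1 / ((1 - r) ^ j * (1 - r))"
      using r by (simp add: n_def exp_minus exp_of_nat_mult algebra_simps exp_diff exp_add powr_def inverse_eq_divide)
    have E2: "?g r powr h = n powr h * (- ln (1 - r)) powr h"
      using r n powr_mult[of n "- ln (1 - r)" h] by simp
    have E3: "n powr (-1 - h) * n * n powr h = 1"
      using n powr_add[of n "-1 - h" 1] powr_add[of n "-h" h] by simp
    have "n powr (-1 - h) * (\<bar>n / (1 - r)\<bar> * (?g r powr h / exp (?g r)))
        = (n powr (-1 - h) * n * n powr h) * ((1 - r) ^ j * (- ln (1 - r)) powr h)"
      unfolding E1 E2 using r n by (simp add: mult_ac)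
    then show "n powr (-1 - h) * (\<bar>n / (1 - r)\<bar> * (?g r powr h / exp (?g r)))
        = (1 - r) ^ j * (- ln (1 - r)) powr h"
      unfolding E3 by simp
  qed (simp add: n_def mult.commute)
next
  define n where "n = real j + 1"
  have n: "n > 0" by (simp add: n_def)
  \<comment> \<open>Uses \<open>Gamma 1 = 1\<close>.\<close>
  have D: "deriv Gamma 1 = (Digamma 1 :: real)"
    using Digamma_eq_deriv_Gamma[of 1] by simp
  show "((\<lambda>h. Gamma (1 + h) * (real j + 1) powr (-1 - h)) has_field_derivative
      (deriv Gamma 1 - ln (real j + 1)) / (real j + 1)) (at 0)"
    unfolding D n_def[symmetric] using n
    by (auto intro!: derivative_eq_intros
        simp: pos_notin_nonpos_Ints powr_minus_divide diff_divide_distrib)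
qed (auto intro!: borel_measurable_unit_interval)

lemma p_coeff_eq_0: "j < i \<Longrightarrow> p_coeff i (real j + 1) = 0"
  by (simp add: p_coeff_def binomial_eq_0 flip: binomial_gbinomial)

text \<open>The binomial theorem, read off from the binomial series, which terminates at
  \<open>j\<close> for the exponent \<open>j\<close>.\<close>

lemma pow_1m_eq_sum:
  assumes "0 < r" "r < 1"
  shows "(1 - r) ^ j = (\<Sum>i\<le>j. p_coeff i (real j + 1) * r ^ i)"
proof -
  have "(\<lambda>i. p_coeff i (real j + 1) * r ^ i) sums (\<Sum>i\<le>j. p_coeff i (real j + 1) * r ^ i)"
    by (rule sums_finite) (auto simp: p_coeff_eq_0)
  moreover have "(\<lambda>i. p_coeff i (real j + 1) * r ^ i) sums (1 - r) powr (real j + 1 - 1)"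
    using assms by (intro p_coeff_sums) auto
  ultimately show ?thesis
    using assms by (simp add: powr_realpow sums_unique2)
qed

lemma entropy_inner_term_sums:
  "(\<lambda>i. entropy_inner_term c j i) sums (\<Sum>i\<le>j. entropy_inner_term c j i)"
  by (rule sums_finite) (auto simp: entropy_inner_term_def p_coeff_eq_0)

text \<open>Source of the innermost sum: \<open>1 - r\<close> and \<open>r powr c\<close> do not
  share one Beta integral, so \<open>(1 - r) ^ j\<close> is expanded in powers of \<open>r\<close>,
  each of which gives a Beta integral with \<open>q = 1\<close>. Only indices
  \<open>i \<le> j\<close> contribute.\<close>

lemma has_bochner_integral_pow_ln1m_powr:
  assumes "c > 0"
  shows "has_bochner_integral unit_interval_measure (\<lambda>r. (1 - r) ^ j * ln (1 - r powr c))
    (\<Sum>i. entropy_inner_term c j i)"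
proof -
  have "has_bochner_integral unit_interval_measure (\<lambda>r. r ^ i * ln (1 - r powr c))
      ((Digamma 1 - Digamma ((real i + 1) / c + 1)) / (real i + 1))" for i
  proof -
    have "has_bochner_integral unit_interval_measure
        (\<lambda>r. r powr (real i + 1 - 1) * (1 - r powr c) powr (1 - 1) * ln (1 - r powr c))
        (Beta ((real i + 1) / c) 1 * (Digamma 1 - Digamma ((real i + 1) / c + 1)) / c)"
      using assms by (intro has_bochner_integral_Beta_powr_ln1m) auto
    then show ?thesis
    proof (rule has_bochner_integral_eq)
      have B: "Beta ((real i + 1) / c) 1 = 1 / ((real i + 1) / c)"
        using assms by (intro Beta_1) auto
      show "Beta ((real i + 1) / c) 1 * (Digamma 1 - Digamma ((real i + 1) / c + 1)) / c
          = (Digamma 1 - Digamma ((real i + 1) / c + 1)) / (real i + 1)"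
        unfolding B
        using assms by (simp add: divide_simps)
    qed (auto simp: powr_realpow)
  qed
  then have "has_bochner_integral unit_interval_measure
      (\<lambda>r. \<Sum>i\<le>j. p_coeff i (real j + 1) * (r ^ i * ln (1 - r powr c)))
      (\<Sum>i\<le>j. p_coeff i (real j + 1) * ((Digamma 1 - Digamma ((real i + 1) / c + 1)) / (real i + 1)))"
    by (intro has_bochner_integral_sum has_bochner_integral_mult_right)
  then show ?thesis
  proof (rule has_bochner_integral_eq)
    fix r assume "r \<in> space unit_interval_measure"
    then show "(\<Sum>i\<le>j. p_coeff i (real j + 1) * (r ^ i * ln (1 - r powr c))) = (1 - r) ^ j * ln (1 - r powr c)"
      using pow_1m_eq_sum[of r j] by (simp add: sum_distrib_right mult.assoc)
  qed (use entropy_inner_term_sums[of c j, THEN sums_unique] in \<open>simp add: entropy_inner_term_def\<close>)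
qed

section \<open>Integrability of the logarithms against the Beta weight\<close>

text \<open>By comparison: \<open>1 - r powr c \<le> n * (1 - r)\<close> for an integer
  \<open>n \<ge> c\<close>, so \<open>\<bar>ln (1 - r)\<bar>\<close> exceeds
  \<open>\<bar>ln (1 - r powr c)\<bar>\<close> by at most \<open>ln n\<close>.\<close>

lemma integrable_Beta_powr_ln_1m:
  fixes p q c :: real
  assumes "p > 0" "q > 0" "c > 0"
  shows "integrable unit_interval_measure (\<lambda>r. r powr (p - 1) * (1 - r powr c) powr (q - 1) * ln (1 - r))"
proof -
  define n where "n = nat \<lceil>c\<rceil>"
  have n: "c \<le> real n" "n \<ge> 1" using assms(3) unfolding n_def by linarith+
  let ?W = "\<lambda>r. r powr (p - 1) * (1 - r powr c) powr (q - 1)"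
  have "integrable unit_interval_measure (\<lambda>r. norm (?W r * ln (1 - r powr c)) + ln n * ?W r)"
    using has_bochner_integral_Beta_powr_ln1m[OF assms] has_bochner_integral_Beta_powr[OF assms]
    by (auto simp: has_bochner_integral_iff)
  then show ?thesis
  proof (rule Bochner_Integration.integrable_bound)
    show "AE r in unit_interval_measure. norm (?W r * ln (1 - r))
        \<le> norm (norm (?W r * ln (1 - r powr c)) + ln n * ?W r)"
    proof (rule AE_I2)
      fix r assume "r \<in> space unit_interval_measure"
      then have r: "0 < r" "r < 1" by auto
      have rc: "r powr c < 1" using powr_less_mono2[of c r 1] assms r by simp
      \<comment> \<open>Bernoulli's inequality for \<open>(1 + (r - 1)) ^ n\<close>.\<close>
      have "1 - real n * (1 - r) \<le> r ^ n"
        using Bernoulli_inequality[of "r - 1" n] r by (simp add: algebra_simps)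
      also have "\<dots> \<le> r powr c"
        using r n powr_mono'[of c "real n" r] by (simp add: powr_realpow)
      finally have "1 - r powr c \<le> real n * (1 - r)" by simp
      then have "ln (1 - r powr c) \<le> ln (real n * (1 - r))"
        using rc by simp
      also have "\<dots> = ln n + ln (1 - r)"
        using n r by (simp add: ln_mult)
      finally have "\<bar>ln (1 - r)\<bar> \<le> \<bar>ln (1 - r powr c)\<bar> + ln n"
        using r by auto
      then have "?W r * \<bar>ln (1 - r)\<bar> \<le> ?W r * (\<bar>ln (1 - r powr c)\<bar> + ln n)"
        by (intro mult_left_mono) auto
      then show "norm (?W r * ln (1 - r)) \<le> norm (norm (?W r * ln (1 - r powr c)) + ln n * ?W r)"
        by (simp add: abs_mult algebra_simps)
    qed
  qed (auto intro!: borel_measurable_unit_interval)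
qed

text \<open>From \<open>r \<le> - ln (1 - r)\<close> and \<open>ln y \<le> y - 1\<close> the double
  logarithm lies between \<open>ln r\<close> and \<open>- ln (1 - r)\<close>, both already
  integrable against the weight.\<close>

lemma integrable_Beta_powr_ln_neg_ln:
  fixes p q c :: real
  assumes "p > 0" "q > 0" "c > 0"
  shows "integrable unit_interval_measure
    (\<lambda>r. r powr (p - 1) * (1 - r powr c) powr (q - 1) * ln (- ln (1 - r)))"
proof -
  let ?W = "\<lambda>r. r powr (p - 1) * (1 - r powr c) powr (q - 1)"
  have "integrable unit_interval_measure (\<lambda>r. norm (?W r * ln r) + norm (?W r * ln (1 - r)))"
    using has_bochner_integral_Beta_powr_ln[OF assms] integrable_Beta_powr_ln_1m[OF assms]
    by (auto simp: has_bochner_integral_iff)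
  then show ?thesis
  proof (rule Bochner_Integration.integrable_bound)
    show "AE r in unit_interval_measure. norm (?W r * ln (- ln (1 - r)))
        \<le> norm (norm (?W r * ln r) + norm (?W r * ln (1 - r)))"
    proof (rule AE_I2)
      fix r assume "r \<in> space unit_interval_measure"
      then have r: "0 < r" "r < 1" by auto
      have r_le: "r \<le> - ln (1 - r)" using r ln_le_minus_one[of "1 - r"] by simp
      then have "ln r \<le> ln (- ln (1 - r))" using r by (subst ln_le_cancel_iff) auto
      moreover have "ln (- ln (1 - r)) \<le> - ln (1 - r)"
        using r r_le ln_le_minus_one[of "- ln (1 - r)"] by simp
      ultimately have "\<bar>ln (- ln (1 - r))\<bar> \<le> \<bar>ln r\<bar> + \<bar>ln (1 - r)\<bar>" by linarith
      then have "?W r * \<bar>ln (- ln (1 - r))\<bar> \<le> ?W r * (\<bar>ln r\<bar> + \<bar>ln (1 - r)\<bar>)"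
        by (intro mult_left_mono) auto
      then show "norm (?W r * ln (- ln (1 - r))) \<le> norm (norm (?W r * ln r) + norm (?W r * ln (1 - r)))"
        by (simp add: abs_mult algebra_simps)
    qed
  qed (auto intro!: borel_measurable_unit_interval)
qed

section \<open>The logarithm of the density as a kernel on the unit interval\<close>

text \<open>Up to the constant \<open>ln (c * \<theta> * \<gamma> / Beta a b)\<close>, this is the negative logarithm of the
  density in the variable \<open>r = 1 - exp (- \<gamma> * x powr (- \<theta>))\<close>.\<close>

definition neg_log_kernel :: "real \<Rightarrow> real \<Rightarrow> real \<Rightarrow> real \<Rightarrow> real \<Rightarrow> real \<Rightarrow> real" where
  "neg_log_kernel \<gamma> \<theta> a b c r =
     (\<theta> + 1) / \<theta> * (ln \<gamma> - ln (- ln (1 - r))) - ln (1 - r)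
     - (a * c - 1) * ln r - (b - 1) * ln (1 - r powr c)"

text \<open>Identifies the braced factor of \<open>entropy_term\<close> as the \<open>j\<close>-th
  moment of the kernel in \<open>1 - r\<close>, each part coming from one of the four
  logarithms.\<close>

lemma has_bochner_integral_pow_neg_log_kernel:
  assumes "c > 0" "\<gamma> > 0"
  shows "has_bochner_integral unit_interval_measure (\<lambda>r. (1 - r) ^ j * neg_log_kernel \<gamma> \<theta> a b c r)
    ((\<theta> + 1) / \<theta> * ((ln ((real j + 1) * \<gamma>) - deriv Gamma 1) / (real j + 1))
        - (a * c - 1) / (real j + 1) * (Digamma 1 - Digamma (real j + 2))
        + 1 / (real j + 1) ^ 2
        - (b - 1) * (\<Sum>i. entropy_inner_term c j i))"
proof -
  have "has_bochner_integral unit_interval_measure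
      (\<lambda>r. (\<theta> + 1) / \<theta> * (ln \<gamma> * (1 - r) ^ j - (1 - r) ^ j * ln (- ln (1 - r)))
        - (1 - r) ^ j * ln (1 - r)
        - (a * c - 1) * ((1 - r) ^ j * ln r) - (b - 1) * ((1 - r) ^ j * ln (1 - r powr c)))
      ((\<theta> + 1) / \<theta> * (ln \<gamma> * (1 / (real j + 1)) - (deriv Gamma 1 - ln (real j + 1)) / (real j + 1))
        - - (1 / (real j + 1)\<^sup>2)
        - (a * c - 1) * ((Digamma 1 - Digamma (real j + 2)) / (real j + 1))
        - (b - 1) * (\<Sum>i. entropy_inner_term c j i))"
    using assms(1)
    by (intro has_bochner_integral_diff has_bochner_integral_mult_right has_bochner_integral_pow
        has_bochner_integral_pow_ln has_bochner_integral_pow_ln1m has_bochner_integral_pow_ln_neg_ln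
        has_bochner_integral_pow_ln1m_powr)
  then show ?thesis
  proof (rule has_bochner_integral_eq)
    have "ln ((real j + 1) * \<gamma>) = ln (real j + 1) + ln \<gamma>"
      using assms by (simp add: ln_mult)
    then have "ln \<gamma> * (1 / (real j + 1)) - (deriv Gamma 1 - ln (real j + 1)) / (real j + 1)
        = (ln ((real j + 1) * \<gamma>) - deriv Gamma 1) / (real j + 1)"
      by (simp add: add_divide_distrib diff_divide_distrib)
    then show "(\<theta> + 1) / \<theta> * (ln \<gamma> * (1 / (real j + 1)) - (deriv Gamma 1 - ln (real j + 1)) / (real j + 1))
        - - (1 / (real j + 1)\<^sup>2)
        - (a * c - 1) * ((Digamma 1 - Digamma (real j + 2)) / (real j + 1))
        - (b - 1) * (\<Sum>i. entropy_inner_term c j i)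
      = (\<theta> + 1) / \<theta> * ((ln ((real j + 1) * \<gamma>) - deriv Gamma 1) / (real j + 1))
        - (a * c - 1) / (real j + 1) * (Digamma 1 - Digamma (real j + 2))
        + 1 / (real j + 1) ^ 2
        - (b - 1) * (\<Sum>i. entropy_inner_term c j i)"
      by simp
  qed (simp add: neg_log_kernel_def algebra_simps)
qed

lemma integrable_Beta_powr_neg_log_kernel:
  fixes p q c :: real
  assumes "p > 0" "q > 0" "c > 0"
  shows "integrable unit_interval_measure
    (\<lambda>r. r powr (p - 1) * (1 - r powr c) powr (q - 1) * neg_log_kernel \<gamma> \<theta> a b c r)"
proof -
  let ?W = "\<lambda>r. r powr (p - 1) * (1 - r powr c) powr (q - 1)"
  have "integrable unit_interval_measure
      (\<lambda>r. (\<theta> + 1) / \<theta> * (ln \<gamma> * ?W r - ?W r * ln (- ln (1 - r))) - ?W r * ln (1 - r)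
        - (a * c - 1) * (?W r * ln r) - (b - 1) * (?W r * ln (1 - r powr c)))"
    by (intro Bochner_Integration.integrable_diff integrable_mult_right
        integrable_Beta_powr_ln_1m[OF assms] integrable_Beta_powr_ln_neg_ln[OF assms]
        has_bochner_integral_Beta_powr[OF assms, THEN has_bochner_integral_iff[THEN iffD1], THEN conjunct1]
        has_bochner_integral_Beta_powr_ln[OF assms, THEN has_bochner_integral_iff[THEN iffD1], THEN conjunct1]
        has_bochner_integral_Beta_powr_ln1m[OF assms, THEN has_bochner_integral_iff[THEN iffD1], THEN conjunct1])
  then show ?thesis
    by (simp add: neg_log_kernel_def algebra_simps)
qed

lemma integrable_powr_neg_log_kernel:
  fixes p c :: real
  assumes "p > 0" "c > 0"
  shows "integrable unit_interval_measure (\<lambda>r. r powr (p - 1) * neg_log_kernel \<gamma> \<theta> a b c r)"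
proof -
  have "integrable unit_interval_measure
      (\<lambda>r. r powr (p - 1) * (1 - r powr c) powr (1 - 1) * neg_log_kernel \<gamma> \<theta> a b c r)"
    using assms by (intro integrable_Beta_powr_neg_log_kernel) auto
  \<comment> \<open>Needed for \<open>(1 - r powr c) powr 0 = 1\<close>, which fails at base
    0.\<close>
  moreover have "r powr c \<noteq> 1" if "0 < r" "r < 1" for r
    using that powr_less_mono2[of c r 1] assms by simp
  ultimately show ?thesis
    by (elim Bochner_Integration.integrable_cong[THEN iffD1, rotated -1, OF _ refl]) auto
qed

section \<open>Summation of the series over \<open>j\<^sub>2\<close> and then over
  \<open>j\<^sub>1\<close>\<close>

text \<open>Termwise integration with \<open>v = 1 - r\<close>, expanding
  \<open>r powr (c * (a + j\<^sub>1) - 1)\<close> in powers of \<open>1 - r\<close>.\<close>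

lemma entropy_term_sums:
  assumes "a > 0" "b > 0" "c > 0" "\<gamma> > 0"
  shows "(\<lambda>j\<^sub>2. entropy_term \<gamma> \<theta> a b c j\<^sub>1 j\<^sub>2) sums
    (p_coeff j\<^sub>1 b * (\<integral>r. r powr (c * (a + real j\<^sub>1) - 1) * neg_log_kernel \<gamma> \<theta> a b c r \<partial>unit_interval_measure))"
proof -
  let ?L = "neg_log_kernel \<gamma> \<theta> a b c"
  let ?s = "c * (a + real j\<^sub>1)"
  have s: "?s > 0" using assms by (intro mult_pos_pos) auto
  \<comment> \<open>The moment of order 0.\<close>
  have L: "integrable unit_interval_measure ?L"
    using has_bochner_integral_pow_neg_log_kernel[OF assms(3,4), of 0]
    by (auto simp: has_bochner_integral_iff)
  have "(\<lambda>j. p_coeff j ?s * (\<integral>r. (1 - r) ^ j * ?L r \<partial>unit_interval_measure)) sums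
      (\<integral>r. (1 - (1 - r)) powr (?s - 1) * ?L r \<partial>unit_interval_measure)"
    using L integrable_powr_neg_log_kernel[OF s assms(3), of \<gamma> \<theta> a b]
    by (intro p_coeff_sums_integral) (auto intro!: borel_measurable_unit_interval)
  from sums_mult[OF this, of "p_coeff j\<^sub>1 b"] show ?thesis
    unfolding entropy_term_def
      has_bochner_integral_pow_neg_log_kernel[OF assms(3,4), THEN has_bochner_integral_integral_eq]
    by (simp add: mult.assoc)
qed

text \<open>Termwise integration with \<open>v = r powr c\<close>; the power
  \<open>(r powr c) ^ j\<close> merges with \<open>r powr (a * c - 1)\<close> into the weight
  handled by \<open>entropy_term_sums\<close>. The sums stay iterated, with no interchange of
  summation.\<close>

lemma entropy_term_double_sums:
  assumes "a > 0" "b > 0" "c > 0" "\<gamma> > 0"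
  shows "(\<lambda>j\<^sub>1. \<Sum>j\<^sub>2. entropy_term \<gamma> \<theta> a b c j\<^sub>1 j\<^sub>2) sums
    (\<integral>r. r powr (a * c - 1) * (1 - r powr c) powr (b - 1) * neg_log_kernel \<gamma> \<theta> a b c r \<partial>unit_interval_measure)"
proof -
  let ?L = "neg_log_kernel \<gamma> \<theta> a b c"
  have ac: "a * c > 0" using assms by simp
  have "(\<lambda>j. p_coeff j b * (\<integral>r. (r powr c) ^ j * (r powr (a * c - 1) * ?L r) \<partial>unit_interval_measure)) sums
      (\<integral>r. (1 - r powr c) powr (b - 1) * (r powr (a * c - 1) * ?L r) \<partial>unit_interval_measure)"
  proof (rule p_coeff_sums_integral)
    show "0 \<le> r powr c \<and> r powr c < 1" if "r \<in> space unit_interval_measure" for r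
      using that powr_less_mono2[of c r 1] assms by simp
    show "integrable unit_interval_measure (\<lambda>r. (1 - r powr c) powr (b - 1) * (r powr (a * c - 1) * ?L r))"
      using integrable_Beta_powr_neg_log_kernel[OF ac assms(2,3), of \<gamma> \<theta> a b] by (simp add: mult_ac)
  qed (use integrable_powr_neg_log_kernel[OF ac assms(3), of \<gamma> \<theta> a b]
      in \<open>auto intro!: borel_measurable_unit_interval\<close>)
  moreover have "(\<integral>r. (r powr c) ^ j * (r powr (a * c - 1) * ?L r) \<partial>unit_interval_measure)
      = (\<integral>r. r powr (c * (a + real j) - 1) * ?L r \<partial>unit_interval_measure)" for j
  proof (rule Bochner_Integration.integral_cong[OF refl])
    fix r assume "r \<in> space unit_interval_measure"
    then have "(r powr c) ^ j * r powr (a * c - 1) = r powr (c * real j + (a * c - 1))"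
      by (simp add: powr_add powr_powr flip: powr_realpow)
    then show "(r powr c) ^ j * (r powr (a * c - 1) * ?L r) = r powr (c * (a + real j) - 1) * ?L r"
      by (simp add: algebra_simps)
  qed
  moreover have "(\<Sum>j\<^sub>2. entropy_term \<gamma> \<theta> a b c j\<^sub>1 j\<^sub>2)
      = p_coeff j\<^sub>1 b * (\<integral>r. r powr (c * (a + real j\<^sub>1) - 1) * ?L r \<partial>unit_interval_measure)" for j\<^sub>1
    using entropy_term_sums[OF assms] by (rule sums_unique[symmetric])
  ultimately show ?thesis
    by (simp add: mult_ac)
qed

section \<open>From the unit interval back to the density on the half-line\<close>

lemma has_bochner_integral_ln_density:
  assumes "a > 0" "b > 0" "c > 0" "\<gamma> > 0" "\<theta> > 0"
  defines "f \<equiv> rGB1_IWei_density \<gamma> \<theta> a b c"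
  shows "has_bochner_integral lborel (\<lambda>x. f x * ln (f x))
    (ln (c * \<theta> * \<gamma> / Beta a b) - c / Beta a b *
      (\<integral>r. r powr (a * c - 1) * (1 - r powr c) powr (b - 1) * neg_log_kernel \<gamma> \<theta> a b c r \<partial>unit_interval_measure))"
    (is "has_bochner_integral _ _ ?v")
proof -
  let ?L = "neg_log_kernel \<gamma> \<theta> a b c"
  let ?W = "\<lambda>r. r powr (a * c - 1) * (1 - r powr c) powr (b - 1)"
  define K where "K = ln (c * \<theta> * \<gamma> / Beta a b)"
  have ac: "a * c > 0" using assms by simp
  have B: "Beta a b > 0"
    using assms by (simp add: Beta_def Gamma_real_pos)
  have "has_bochner_integral unit_interval_measure ?W (Beta a b / c)"
    using has_bochner_integral_Beta_powr[OF ac assms(2,3)] assms(3) by simp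
  \<comment> \<open>The weight has total mass \<open>Beta a b / c\<close>, so normalisation leaves
    the constant \<open>K\<close> with coefficient 1.\<close>
  then have "has_bochner_integral unit_interval_measure
      (\<lambda>r. c / Beta a b * (K * ?W r - ?W r * ?L r))
      (c / Beta a b * (K * (Beta a b / c) - (\<integral>r. ?W r * ?L r \<partial>unit_interval_measure)))"
    using integrable_Beta_powr_neg_log_kernel[OF ac assms(2,3), of \<gamma> \<theta> a b]
    by (intro has_bochner_integral_mult_right has_bochner_integral_diff has_bochner_integral_integrable)
  then have I: "has_bochner_integral unit_interval_measure (\<lambda>r. c / Beta a b * ?W r * (K - ?L r)) ?v"
    by (rule has_bochner_integral_eq) (use B assms in \<open>simp_all add: K_def algebra_simps diff_divide_distrib\<close>)
  define u where "u x = exp (- \<gamma> * x powr (- \<theta>))" for x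
  define g where "g x = 1 - u x" for x
  \<comment> \<open>The derivative of \<open>g\<close>; it is negative because \<open>g\<close>
    decreases, and its absolute value supplies the remaining factors of the density.\<close>
  define g' where "g' x = - (\<gamma> * \<theta> * x powr (- \<theta> - 1) * u x)" for x
  have img: "g ` {0<..} = {0<..<1}"
  proof (intro equalityI subsetI)
    fix r :: real assume r: "r \<in> {0<..<1}"
    \<comment> \<open>Inversion of \<open>g\<close> in two stages, \<open>y\<close> being the value
      of \<open>x powr (- \<theta>)\<close>.\<close>
    define y where "y = - ln (1 - r) / \<gamma>"
    define x where "x = y powr (- (1 / \<theta>))"
    have "y > 0" unfolding y_def using r assms by (intro divide_pos_pos) auto
    then have "x > 0" "x powr (- \<theta>) = y"
      using assms by (auto simp: x_def powr_powr)
    then have "g x = r" "x \<in> {0<..}"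
      using r assms by (auto simp: g_def u_def y_def)
    then show "r \<in> g ` {0<..}" by blast
  qed (use assms in \<open>auto simp: g_def u_def\<close>)
  have inj: "inj_on g {0<..}"
  proof (rule inj_onI)
    fix x y assume xy: "x \<in> {0<..}" "y \<in> {0<..}" "g x = g y"
    then have "x powr (- \<theta>) = y powr (- \<theta>)" using assms by (simp add: g_def u_def)
    then have "(x powr (- \<theta>)) powr (- (1 / \<theta>)) = (y powr (- \<theta>)) powr (- (1 / \<theta>))" by simp
    then show "x = y" using xy assms by (simp add: powr_powr)
  qed
  have der: "(g has_field_derivative g' x) (at x)" if "x \<in> {0<..}" for x
    unfolding g_def u_def g'_def using that
    by (auto intro!: derivative_eq_intros)
  have "has_bochner_integral (lebesgue_on {0<..})
      (\<lambda>x. \<bar>g' x\<bar> * (c / Beta a b * ?W (g x) * (K - ?L (g x)))) ?v"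
    using I der inj by (subst has_bochner_integral_change_of_variables) (auto simp: img)
  then have "has_bochner_integral (lebesgue_on {0<..}) (\<lambda>x. f x * ln (f x)) ?v"
  proof (rule has_bochner_integral_eq)
    fix x :: real assume "x \<in> space (lebesgue_on {0<..})"
    then have x: "x > 0" by simp
    have u: "0 < u x" "u x < 1" using assms x by (auto simp: u_def)
    have gc: "0 < 1 - g x powr c"
      using u assms powr_less_mono2[of c "g x" 1] by (simp add: g_def)
    have f: "f x = (c * \<theta> * \<gamma> / Beta a b) * x powr (- \<theta> - 1) * u x
        * g x powr (a * c - 1) * (1 - g x powr c) powr (b - 1)"
      using x by (simp add: f_def rGB1_IWei_density_def u_def g_def)
    have "\<bar>g' x\<bar> * (c / Beta a b * ?W (g x)) = f x"
      using x assms u unfolding f g'_def by (simp add: abs_mult)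
    moreover have "ln (f x) = K - ?L (g x)"
    proof -
      have "ln (f x) = K + (- \<theta> - 1) * ln x + ln (u x) + (a * c - 1) * ln (g x)
          + (b - 1) * ln (1 - g x powr c)"
      proof -
        have "c * \<theta> * \<gamma> / Beta a b > 0" using assms B by (intro divide_pos_pos mult_pos_pos) auto
        moreover have "g x > 0" using u by (simp add: g_def)
        ultimately show ?thesis
          unfolding f K_def using assms(1-5) B x u gc by (simp add: ln_mult ln_powr del: times_divide_eq_left)
      qed
      moreover have "?L (g x) = (\<theta> + 1) * ln x - ln (u x) - (a * c - 1) * ln (g x)
          - (b - 1) * ln (1 - g x powr c)"
      proof -
        have "1 - g x = u x" "- ln (u x) = \<gamma> * x powr (- \<theta>)" by (simp_all add: g_def u_def)
        \<comment> \<open>Multiplied by \<open>(\<theta> + 1) / \<theta>\<close>, this accounts for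
          the power \<open>x powr (- \<theta> - 1)\<close> in the density.\<close>
        moreover have "ln \<gamma> - ln (\<gamma> * x powr (- \<theta>)) = \<theta> * ln x"
          using assms x by (simp add: ln_mult ln_powr)
        ultimately show ?thesis
          using assms(5) by (simp add: neg_log_kernel_def)
      qed
      ultimately show ?thesis
        by (simp add: algebra_simps)
    qed
    ultimately show "\<bar>g' x\<bar> * (c / Beta a b * ?W (g x) * (K - ?L (g x))) = f x * ln (f x)"
      by (simp only: mult.assoc[of "\<bar>g' x\<bar>", symmetric])
  qed simp
  \<comment> \<open>The integrand vanishes off the half-line because \<open>f\<close> does. Borel
    measurability then permits the passage from the completed measure to
    \<open>lborel\<close>.\<close>
  then have "has_bochner_integral lebesgue (\<lambda>x. f x * ln (f x)) ?v"
    by (simp add: has_bochner_integral_restrict_space)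
       (erule has_bochner_integral_eq, auto simp: f_def rGB1_IWei_density_def)
  moreover have "(\<lambda>x. f x * ln (f x)) \<in> borel_measurable lborel"
    unfolding f_def rGB1_IWei_density_def by measurable
  ultimately show ?thesis
    by (simp add: has_bochner_integral_iff integrable_completion integral_completion)
qed

section \<open>Transfer to the random variable\<close>

text \<open>Integrability and summability are asserted explicitly, since expectations and infinite
  sums also denote values when they do not converge.\<close>

theorem proposition4:
  fixes a b c \<gamma> \<theta> :: real
    and M :: "'s measure" and X :: "'s \<Rightarrow> real"
  assumes "a > 0" and "b > 0" and "c > 0" and "\<gamma> > 0" and "\<theta> > 0"
    and "prob_space M"
    and "rGB1_IWei_distributed M X \<gamma> \<theta> a b c"
  shows "integrable M (\<lambda>\<omega>. ln (rGB1_IWei_density \<gamma> \<theta> a b c (X \<omega>)))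
    \<and> (\<forall>j\<^sub>2. summable (\<lambda>i. entropy_inner_term c j\<^sub>2 i))
    \<and> (\<forall>j\<^sub>1. summable (\<lambda>j\<^sub>2. entropy_term \<gamma> \<theta> a b c j\<^sub>1 j\<^sub>2))
    \<and> summable (\<lambda>j\<^sub>1. \<Sum>j\<^sub>2. entropy_term \<gamma> \<theta> a b c j\<^sub>1 j\<^sub>2)
    \<and> shannon_entropy M X (rGB1_IWei_density \<gamma> \<theta> a b c) =
        - ln (c * \<theta> * \<gamma> / Beta a b)
        + c / Beta a b * (\<Sum>j\<^sub>1. \<Sum>j\<^sub>2. entropy_term \<gamma> \<theta> a b c j\<^sub>1 j\<^sub>2)"
proof -
  define f where "f = rGB1_IWei_density \<gamma> \<theta> a b c"
  have D: "distributed M lborel X (\<lambda>x. ennreal (f x))"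
    using assms(7) by (simp add: rGB1_IWei_distributed_def f_def)
  have meas: "(\<lambda>x. ln (f x)) \<in> borel_measurable lborel"
    unfolding f_def rGB1_IWei_density_def by measurable
  have "Beta a b > 0"
    using assms by (simp add: Beta_def Gamma_real_pos)
  then have nonneg: "f x \<ge> 0" for x
    using assms by (simp add: f_def rGB1_IWei_density_def)
  note I = has_bochner_integral_ln_density[OF assms(1-5), folded f_def]
  have "integrable M (\<lambda>\<omega>. ln (f (X \<omega>)))"
    using distributed_integrable[OF D meas nonneg] I by (simp add: has_bochner_integral_iff)
  moreover have "shannon_entropy M X f = - ln (c * \<theta> * \<gamma> / Beta a b)
      + c / Beta a b * (\<Sum>j\<^sub>1. \<Sum>j\<^sub>2. entropy_term \<gamma> \<theta> a b c j\<^sub>1 j\<^sub>2)"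
    \<comment> \<open>The expectation becomes the \<open>lborel\<close> integral of
      \<open>f x * ln (f x)\<close>, and the kernel integral in its value is the iterated
      sum.\<close>
    unfolding shannon_entropy_def distributed_integral[OF D meas nonneg, symmetric]
      has_bochner_integral_integral_eq[OF I]
      entropy_term_double_sums[OF assms(1-4), THEN sums_unique, symmetric]
    by simp
  ultimately show ?thesis
    using entropy_inner_term_sums[THEN sums_summable] entropy_term_sums[OF assms(1-4), THEN sums_summable]
      entropy_term_double_sums[OF assms(1-4), THEN sums_summable]
    by (simp add: f_def)
qed

end
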